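(* Let $n \ge 3$ and let $f(\mathbf{z}) = \mathbf{z}^T A \mathbf{z} + \mathbf{b}^T \mathbf{z} + c \in \mathbb{R}[z_1,\dots,z_n]$ be a quadratic polynomial with $A \in \mathbb{R}^{n\times n}$ symmetric, $\mathbf{b} \in \mathbb{R}^n$, $c \in \mathbb{R}$. Let $f$ be of type (II), with $A$ having signature $(n-1,1)$, and let $\mathrm{in}(f)$ be irreducible. Let $K \subseteq \mathbb{R}^n$ be a proper cone and $M(\mathbf{x}) = \sum_{j=1}^n M_j x_j$, with symmetric $l\times l$ matrices $M_j$, be a linear matrix pencil with $K = \{\mathbf{x} \in \mathbb{R}^n : M(\mathbf{x}) \succeq 0\}$. Let $T \in GL(n,\mathbb{R})$ be a matrix with $\mathrm{in}(f)(\mathbf{z}) = \sum_{j=1}^{n-1} ((T\mathbf{z})_j)^2 - ((T\mathbf{z})_n)^2$, and let $$F(\mathbf{x}) = \sum_{p=1}^n F_p x_p := \begin{pmatrix} (T\mathbf{x})_n & & & (T\mathbf{x})_1 \\ & \ddots & & \vdots \\ & & (T\mathbf{x})_n & (T\mathbf{x})_{n-1} \\ (T\mathbf{x})_1 & \cdots & (T\mathbf{x})_{n-1} & (T\mathbf{x})_n \end{pmatrix}$$ be the $n \times n$ linear matrix pencil with upper left block $(T\mathbf{x})_n I_{n-1}$, last row and last column $((T\mathbf{x})_1, \ldots, (T\mathbf{x})_{n-1}, (T\mathbf{x})_n)$. If there exists a block matrix $C = (C_{ij})_{i,j=1}^l$ with blocks $C_{ij}$ of size $n \times n$ and $$C =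 (C_{ij})_{i,j=1}^l \succeq 0, \qquad \sigma F_p = \sum_{i,j=1}^l (M_p)_{ij} C_{ij} \quad \text{for all } p = 1, \ldots, n,$$ for some $\sigma \in \{-1,1\}$, then $f$ is $K$-stable. Deciding whether such a block matrix $C$ exists is a semidefinite feasibility problem.
   Context: A proper cone in $\mathbb{R}^n$ is a full-dimensional, closed, pointed convex cone. A polynomial $f \in \mathbb{C}[z_1,\dots,z_n]$ is $K$-stable if $f(\mathbf{z}) \neq 0$ whenever $\mathbf{z} \in \mathbb{C}^n$ has componentwise imaginary part in the interior of $K$. The initial form $\mathrm{in}(f)$ is the homogeneous part of $f$ of top degree; here $\mathrm{in}(f)(\mathbf{z}) = \mathbf{z}^T A \mathbf{z}$. A quadratic polynomial $f \in \mathbb{R}[z_1,\dots,z_n]$ is of type (II) if it can be transformed by an invertible affine real change of variables to a normal form $\sum_{j=1}^p z_j^2 - \sum_{j=p+1}^r z_j^2 + 1$ with $0 \le p \le r$, $1 \le r \le n$. Signature $(n-1,1)$ means $n-1$ positive eigenvalues and one negative eigenvalue. $X \succeq 0$ means that the symmetric or Hermitian matrix $X$ is positive semidefinite. A semidefinite feasibility problem is the problem of deciding whether there is a positive semidefinite matrix whose entries satisfy a given finite system of linear equations. *)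

theory Defs
  imports
    "HOL-Analysis.Analysis"
    "HOL-Library.Poly_Mapping"
begin

(* Polynomials in finitely many variables indexed by 'n: finitely supported maps from exponent
   vectors to coefficients; the ring structure is the convolution product of Poly_Mapping. *)
type_synonym ('n, 'a) mpoly = "('n \<Rightarrow>\<^sub>0 nat) \<Rightarrow>\<^sub>0 'a"

definition Const :: "'a \<Rightarrow> ('n, 'a::zero) mpoly" where
  "Const a = Poly_Mapping.single 0 a"

definition Var :: "'n \<Rightarrow> ('n, 'a::zero_neq_one) mpoly" where
  "Var i = Poly_Mapping.single (Poly_Mapping.single i 1) 1"

definition poly_eval :: "('n::finite, 'a::comm_semiring_1) mpoly \<Rightarrow> ('n \<Rightarrow> 'a) \<Rightarrow> 'a" where
  "poly_eval f z = (\<Sum>m\<in>Poly_Mapping.keys f.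
     Poly_Mapping.lookup f m * (\<Prod>i\<in>UNIV. z i ^ Poly_Mapping.lookup m i))"

definition poly_subst ::
    "('n::finite, 'a::comm_semiring_1) mpoly \<Rightarrow> ('n \<Rightarrow> ('n, 'a) mpoly) \<Rightarrow> ('n, 'a) mpoly" where
  "poly_subst f g = (\<Sum>m\<in>Poly_Mapping.keys f.
     Const (Poly_Mapping.lookup f m) * (\<Prod>i\<in>UNIV. g i ^ Poly_Mapping.lookup m i))"

definition complexify :: "('n, real) mpoly \<Rightarrow> ('n, complex) mpoly" where
  "complexify f = Poly_Mapping.map complex_of_real f"

definition monom_degree :: "('n::finite \<Rightarrow>\<^sub>0 nat) \<Rightarrow> nat" where
  "monom_degree m = (\<Sum>i\<in>UNIV. Poly_Mapping.lookup m i)"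

(* The inserted 0 only matters for the zero polynomial. *)
definition total_degree :: "('n::finite, 'a::zero) mpoly \<Rightarrow> nat" where
  "total_degree f = Max (insert 0 (monom_degree ` Poly_Mapping.keys f))"

definition initial_form :: "('n::finite, 'a::comm_monoid_add) mpoly \<Rightarrow> ('n, 'a) mpoly" where
  "initial_form f = (\<Sum>m\<in>{m\<in>Poly_Mapping.keys f. monom_degree m = total_degree f}.
     Poly_Mapping.single m (Poly_Mapping.lookup f m))"

definition quadratic_poly ::
    "real^'n^'n \<Rightarrow> real^'n \<Rightarrow> real \<Rightarrow> ('n::finite, real) mpoly" where
  "quadratic_poly A b c =
     (\<Sum>i\<in>UNIV. \<Sum>j\<in>UNIV. Const (A $ i $ j) * Var i * Var j)
     + (\<Sum>i\<in>UNIV. Const (b $ i) * Var i) + Const c"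

(* The linear form z \<mapsto> (S z)_i as a polynomial. *)
definition lin_form :: "real^'n^'n \<Rightarrow> 'n \<Rightarrow> ('n::finite, real) mpoly" where
  "lin_form S i = (\<Sum>k\<in>UNIV. Const (S $ i $ k) * Var k)"

(* The coordinates are numbered 1, ..., CARD('n) along the linear order of the index type, so
   the n-th coordinate has index last_idx. *)
definition pos :: "'n::{finite,linorder} \<Rightarrow> nat" where
  "pos i = card {..i}"

definition last_idx :: "'n::{finite,linorder}" where
  "last_idx = Max UNIV"

definition normal_form_II :: "nat \<Rightarrow> nat \<Rightarrow> ('n::{finite,linorder}, real) mpoly" where
  "normal_form_II p r =
     (\<Sum>j | 1 \<le> pos j \<and> pos j \<le> p. Var j ^ 2)
     - (\<Sum>j | p + 1 \<le> pos j \<and> pos j \<le> r. Var j ^ 2) + 1"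

definition type_II :: "('n::{finite,linorder}, real) mpoly \<Rightarrow> bool" where
  "type_II f \<longleftrightarrow> (\<exists>(S::real^'n::_^'n::_) (t::real^'n::_) p r.
     invertible S \<and> p \<le> r \<and> 1 \<le> r \<and> r \<le> CARD('n) \<and>
     poly_subst f (\<lambda>i. lin_form S i + Const (t $ i)) = normal_form_II p r)"

definition charpoly :: "real^'n^'n \<Rightarrow> real poly" where
  "charpoly A = det (\<chi> i j. (if i = j then [:0, 1:] else 0) - [:A $ i $ j:])"

(* p positive and q negative eigenvalues, counted with multiplicity. *)
definition has_signature :: "real^'n^'n \<Rightarrow> nat \<Rightarrow> nat \<Rightarrow> bool" where
  "has_signature A p q \<longleftrightarrow>
     size {#x \<in># proots (charpoly A). x > 0#} = p \<and>
     size {#x \<in># proots (charpoly A). x < 0#} = q"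

definition symmetric_matrix :: "'a^'n^'n \<Rightarrow> bool" where
  "symmetric_matrix X \<longleftrightarrow> transpose X = X"

definition psd :: "real^'n^'n \<Rightarrow> bool" where
  "psd X \<longleftrightarrow> symmetric_matrix X \<and> (\<forall>v. 0 \<le> v \<bullet> (X *v v))"

definition proper_cone :: "(real^'n) set \<Rightarrow> bool" where
  "proper_cone K \<longleftrightarrow>
     convex_cone K \<and> closed K \<and> aff_dim K = int CARD('n) \<and> K \<inter> uminus ` K = {0}"

definition K_stable :: "(real^'n) set \<Rightarrow> ('n::finite, complex) mpoly \<Rightarrow> bool" where
  "K_stable K f \<longleftrightarrow>
     (\<forall>z::complex^'n. (\<chi> i. Im (z $ i)) \<in> interior K \<longrightarrow> poly_eval f (\<lambda>i. z $ i) \<noteq> 0)"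

definition pencil :: "('n \<Rightarrow> real^'l^'l) \<Rightarrow> real^'n \<Rightarrow> real^'l^'l" where
  "pencil M x = (\<Sum>j\<in>UNIV. x $ j *\<^sub>R M j)"

(* Upper left block y_n I, last row and column (y_1, ..., y_n). *)
definition arrow_matrix :: "real^'n::_ \<Rightarrow> real^'n::_^'n::{finite,linorder}" where
  "arrow_matrix y = (\<chi> i j.
     if i = last_idx then y $ j
     else if j = last_idx then y $ i
     else if i = j then y $ last_idx
     else 0)"

(* A block matrix (C_ij) with i, j in 'l and blocks of format 'n x 'n is indexed by 'l x 'n. *)
definition block :: "real^('l::finite \<times> 'n::finite)^('l \<times> 'n) \<Rightarrow> 'l \<Rightarrow> 'l \<Rightarrow> real^'n^'n" where
  "block C i j = (\<chi> a b. C $ (i, a) $ (j, b))"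

definition block_certificate ::
    "real \<Rightarrow> ('n \<Rightarrow> real^'l^'l) \<Rightarrow> ('n \<Rightarrow> real^'n^'n) \<Rightarrow> real^('l::finite \<times> 'n::finite)^('l \<times> 'n) \<Rightarrow> bool" where
  "block_certificate \<sigma> M F C \<longleftrightarrow> psd C \<and>
     (\<forall>p. \<sigma> *\<^sub>R F p = (\<Sum>i\<in>UNIV. \<Sum>j\<in>UNIV. (M p $ i $ j) *\<^sub>R block C i j))"

(* A system is a set of pairs (G, \<beta>), each standing for the linear equation
   \<Sum>i j. G_ij X_ij = \<beta> in the entries of X. *)
definition sdp_solutions :: "((real^'m^'m) \<times> real) set \<Rightarrow> (real^'m^'m) set" where
  "sdp_solutions L = {X. psd X \<and>
     (\<forall>(G, \<beta>)\<in>L. (\<Sum>i\<in>UNIV. \<Sum>j\<in>UNIV. G $ i $ j * X $ i $ j) = \<beta>)}"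

(* Deciding whether a matrix with property P exists is a semidefinite feasibility problem: the
   matrices with property P are exactly the positive semidefinite solutions of a finite linear
   system. Requiring only that both questions have the same answer would be vacuous. *)
definition semidefinite_feasibility_problem :: "(real^'m^'m \<Rightarrow> bool) \<Rightarrow> bool" where
  "semidefinite_feasibility_problem P \<longleftrightarrow> (\<exists>L. finite L \<and> {X. P X} = sdp_solutions L)"

end

theory Submission
  imports Defs
begin

text \<open>
  Comparing the values of \<open>f\<close> at \<open>t + u\<close> and \<open>t - u\<close>, where \<open>t\<close> is the translation that brings
  \<open>f\<close> to its normal form, shows \<open>f (t + u) = q (T u) + 1\<close> with the Lorentz form
  \<open>q y = y\<^sub>1\<^sup>2 + \<dots> + y\<^sub>n\<^sub>-\<^sub>1\<^sup>2 - y\<^sub>n\<^sup>2\<close>. At a zero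
  \<open>z = t + u + \<i> v\<close> the real part gives \<open>q (T u) - q (T v) + 1 = 0\<close> and the imaginary part makes
  \<open>T u\<close> and \<open>T v\<close> orthogonal for \<open>q\<close>. If \<open>q (T v) < 0\<close>, the reverse Cauchy--Schwarz inequality gives
  \<open>q (T u) \<ge> 0\<close>, a contradiction. So it suffices that \<open>q (T v) < 0\<close> on the interior of \<open>K\<close>. The
  certificate writes \<open>\<sigma> w\<^sup>T F(x) w\<close> as the Frobenius product of \<open>M(x)\<close> with the positive semidefinite
  matrix \<open>(w\<^sup>T C\<^sub>i\<^sub>j w)\<close>, so \<open>\<sigma> F\<close> is semidefinite on \<open>K\<close>, and a semidefinite arrow matrix forces its
  vector into the closed Lorentz cone.
\<close>

section \<open>Evaluating real polynomials in real algebras\<close>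

text \<open>The value may lie in any commutative real algebra, so one set of rules covers real
  points and the complex points of a complexified polynomial.\<close>

definition real_eval ::
    "('n::finite, real) mpoly \<Rightarrow> ('n \<Rightarrow> 'b) \<Rightarrow> 'b::{comm_ring_1,real_algebra_1}" where
  "real_eval f z = (\<Sum>m\<in>Poly_Mapping.keys f.
     of_real (Poly_Mapping.lookup f m) * (\<Prod>i\<in>UNIV. z i ^ Poly_Mapping.lookup m i))"

lemma poly_eval_complexify: "poly_eval (complexify f) z = real_eval f z"
proof -
  have "Poly_Mapping.keys (complexify f) = Poly_Mapping.keys f"
    unfolding complexify_def
    by (rule set_eqI) (simp add: in_keys_iff Poly_Mapping.map.rep_eq when_def)
  moreover have "Poly_Mapping.lookup (complexify f) m = of_real (Poly_Mapping.lookup f m)" for m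
    unfolding complexify_def by (simp add: Poly_Mapping.map.rep_eq when_def)
  ultimately show ?thesis by (simp add: poly_eval_def real_eval_def)
qed

text \<open>Terms outside the support vanish, so polynomials with different supports can be summed
  over a common index set. Addition needs this because cancellation may shrink the support.\<close>

lemma real_eval_superset:
  assumes "finite S" "Poly_Mapping.keys f \<subseteq> S"
  shows "real_eval f z = (\<Sum>m\<in>S.
     of_real (Poly_Mapping.lookup f m) * (\<Prod>i\<in>UNIV. z i ^ Poly_Mapping.lookup m i))"
  unfolding real_eval_def
  by (rule sum.mono_neutral_left) (use assms in \<open>auto simp: in_keys_iff\<close>)

lemma real_eval_zero [simp]: "real_eval 0 z = 0"
  by (simp add: real_eval_def)

lemma real_eval_single [simp]:
  "real_eval (Poly_Mapping.single m a) z = of_real a * (\<Prod>i\<in>UNIV. z i ^ Poly_Mapping.lookup m i)"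
  by (subst real_eval_superset[of "{m}"]) auto

lemma real_eval_add [simp]: "real_eval (f + g) z = real_eval f z + real_eval g z"
proof -
  let ?S = "Poly_Mapping.keys f \<union> Poly_Mapping.keys g"
  have "real_eval h z = (\<Sum>m\<in>?S.
     of_real (Poly_Mapping.lookup h m) * (\<Prod>i\<in>UNIV. z i ^ Poly_Mapping.lookup m i))"
    if "Poly_Mapping.keys h \<subseteq> ?S" for h
    by (rule real_eval_superset) (use that in auto)
  from this[of f] this[of g] this[of "f + g"] show ?thesis
    using keys_add[of f g] by (simp add: lookup_add algebra_simps sum.distrib)
qed

lemma real_eval_sum [simp]: "real_eval (\<Sum>i\<in>I. f i) z = (\<Sum>i\<in>I. real_eval (f i) z)"
  by (induction I rule: infinite_finite_induct) auto

lemma real_eval_diff [simp]: "real_eval (f - g) z = real_eval f z - real_eval g z"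
  using real_eval_add[of "f - g" g z] by (simp add: eq_diff_eq del: real_eval_add)

lemma sum_single_lookup:
  fixes f :: "'a \<Rightarrow>\<^sub>0 'b::comm_monoid_add"
  shows "(\<Sum>m\<in>Poly_Mapping.keys f. Poly_Mapping.single m (Poly_Mapping.lookup f m)) = f"
  by (rule poly_mapping_eqI)
     (auto simp: lookup_sum lookup_single when_def in_keys_iff)

text \<open>Splitting both factors into monomials reduces the claim to the power law for
  exponents.\<close>

lemma real_eval_mult [simp]: "real_eval (f * g) z = real_eval f z * real_eval g z"
proof -
  let ?s = "\<lambda>f m. Poly_Mapping.single m (Poly_Mapping.lookup f m)"
  have "f * g = (\<Sum>m\<in>Poly_Mapping.keys f. ?s f m) * (\<Sum>m\<in>Poly_Mapping.keys g. ?s g m)"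
    by (simp only: sum_single_lookup)
  also have "real_eval \<dots> z =
      (\<Sum>m\<in>Poly_Mapping.keys f. real_eval (?s f m) z) * (\<Sum>m\<in>Poly_Mapping.keys g. real_eval (?s g m) z)"
    by (simp add: sum_product mult_single lookup_add power_add prod.distrib mult_ac)
  also have "\<dots> = real_eval f z * real_eval g z"
    by (simp only: real_eval_sum[symmetric] sum_single_lookup)
  finally show ?thesis .
qed

lemma real_eval_Const [simp]: "real_eval (Const a) z = of_real a"
  by (simp add: Const_def)

lemma real_eval_one [simp]: "real_eval 1 z = 1"
  using real_eval_Const[of 1 z] by (simp add: Const_def del: real_eval_Const)

lemma real_eval_Var [simp]: "real_eval (Var i) z = z i"
proof -
  have "z j ^ Poly_Mapping.lookup (Poly_Mapping.single i 1) j = (if j = i then z j else 1)" for j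
    by (simp add: lookup_single when_def)
  then show ?thesis by (simp add: Var_def)
qed

lemma real_eval_power [simp]: "real_eval (f ^ k) z = real_eval f z ^ k"
  by (induction k) auto

lemma real_eval_prod [simp]: "real_eval (\<Prod>i\<in>I. f i) z = (\<Prod>i\<in>I. real_eval (f i) z)"
  by (induction I rule: infinite_finite_induct) auto

lemma real_eval_poly_subst:
  fixes x :: "'n::finite \<Rightarrow> real"
  shows "real_eval (poly_subst f g) x = real_eval f (\<lambda>i. real_eval (g i) x)"
  by (simp add: poly_subst_def real_eval_def[of f])

lemma real_eval_lin_form:
  "real_eval (lin_form S i) (\<lambda>k. x $ k) = (S *v x) $ i"
  by (simp add: lin_form_def matrix_vector_mult_def)

section \<open>Quadratic polynomials at real and complex points\<close>

lemma real_eval_quadratic_poly: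
  "real_eval (quadratic_poly A b c) z =
     (\<Sum>i\<in>UNIV. \<Sum>j\<in>UNIV. of_real (A $ i $ j) * z i * z j) + (\<Sum>i\<in>UNIV. of_real (b $ i) * z i) + of_real c"
  by (simp add: quadratic_poly_def)

lemma inner_matrix_vector_sum:
  fixes A :: "real^'n^'m"
  shows "u \<bullet> (A *v v) = (\<Sum>i\<in>UNIV. \<Sum>j\<in>UNIV. u $ i * v $ j * A $ i $ j)"
  by (simp add: inner_vec_def matrix_vector_mult_def sum_distrib_left mult_ac)

lemma real_eval_quadratic_poly_real:
  "real_eval (quadratic_poly A b c) (\<lambda>i. x $ i) = x \<bullet> (A *v x) + b \<bullet> x + c"
  by (simp add: real_eval_quadratic_poly inner_matrix_vector_sum)
     (simp add: inner_vec_def mult_ac)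

lemma inner_symmetric_matrix:
  fixes A :: "real^'n^'n"
  assumes "symmetric_matrix A"
  shows "u \<bullet> (A *v v) = v \<bullet> (A *v u)"
  using assms by (metis dot_lmul_matrix inner_commute symmetric_matrix_def
      vector_transpose_matrix)

lemma Re_Im_real_eval_quadratic_poly:
  fixes z :: "complex^'n::finite"
  assumes "symmetric_matrix A"
  defines "x \<equiv> \<chi> i. Re (z $ i)" and "y \<equiv> \<chi> i. Im (z $ i)"
  shows "Re (real_eval (quadratic_poly A b c) (\<lambda>i. z $ i)) =
           x \<bullet> (A *v x) - y \<bullet> (A *v y) + b \<bullet> x + c" (is ?re)
    and "Im (real_eval (quadratic_poly A b c) (\<lambda>i. z $ i)) = 2 * (x \<bullet> (A *v y)) + b \<bullet> y" (is ?im)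
proof -
  show ?re
    unfolding real_eval_quadratic_poly inner_matrix_vector_sum x_def y_def
    by (simp add: inner_vec_def algebra_simps sum_subtractf)
  have "Im (real_eval (quadratic_poly A b c) (\<lambda>i. z $ i)) = x \<bullet> (A *v y) + y \<bullet> (A *v x) + b \<bullet> y"
    unfolding real_eval_quadratic_poly inner_matrix_vector_sum x_def y_def
    by (simp add: inner_vec_def algebra_simps sum.distrib)
  then show ?im using inner_symmetric_matrix[OF assms(1), of y x] by simp
qed

section \<open>Pairing of semidefinite forms\<close>

text \<open>Gaussian elimination: if \<open>X s s > 0\<close>, subtracting the rank one
  matrix \<open>X i s * X j s / X s s\<close> leaves a form that is semidefinite on the remaining indices.\<close>

lemma psd_form_pairing_nonneg:
  fixes X Y :: "'a \<Rightarrow> 'a \<Rightarrow> real"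
  assumes "finite S" "\<And>i j. X i j = X j i"
    and "\<And>v. 0 \<le> (\<Sum>i\<in>S. \<Sum>j\<in>S. v i * v j * X i j)"
    and "\<And>v. 0 \<le> (\<Sum>i\<in>S. \<Sum>j\<in>S. v i * v j * Y i j)"
  shows "0 \<le> (\<Sum>i\<in>S. \<Sum>j\<in>S. X i j * Y i j)"
  using assms
proof (induction S arbitrary: X rule: finite_induct)
  case empty
  then show ?case by simp
next
  case (insert s S)
  note X = insert.prems(2) and Y = insert.prems(3) and sym = insert.prems(1)
  have symS: "X s j = X j s" if "j \<in> S" for j by (rule sym)
  have split: "(\<Sum>i\<in>insert s S. \<Sum>j\<in>insert s S. v i * v j * Z i j) =
      (v s)\<^sup>2 * Z s s + v s * (\<Sum>j\<in>S. v j * (Z s j + Z j s)) + (\<Sum>i\<in>S. \<Sum>j\<in>S. v i * v j * Z i j)"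
    for v and Z :: "'a \<Rightarrow> 'a \<Rightarrow> real"
    using insert.hyps
    by (simp add: sum.distrib sum_distrib_left power2_eq_square algebra_simps)
  have Y': "0 \<le> (\<Sum>i\<in>S. \<Sum>j\<in>S. v i * v j * Y i j)" for v
  proof -
    have "(\<Sum>i\<in>S. \<Sum>j\<in>S. (v(s := 0)) i * (v(s := 0)) j * Y i j) = (\<Sum>i\<in>S. \<Sum>j\<in>S. v i * v j * Y i j)"
      by (intro sum.cong refl) (use insert.hyps in auto)
    then show ?thesis using Y[of "v(s := 0)"] unfolding split by simp
  qed
  have form: "0 \<le> a\<^sup>2 * X s s + 2 * a * (\<Sum>j\<in>S. v j * X j s) + (\<Sum>i\<in>S. \<Sum>j\<in>S. v i * v j * X i j)"
    for a v
  proof -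
    have "(\<Sum>i\<in>S. \<Sum>j\<in>S. (v(s := a)) i * (v(s := a)) j * X i j) = (\<Sum>i\<in>S. \<Sum>j\<in>S. v i * v j * X i j)"
      by (intro sum.cong refl) (use insert.hyps in auto)
    moreover have "(\<Sum>j\<in>S. (v(s := a)) j * (X s j + X j s)) = 2 * (\<Sum>j\<in>S. v j * X j s)"
      unfolding sum_distrib_left by (intro sum.cong refl) (use insert.hyps symS in auto)
    ultimately show ?thesis using X[of "v(s := a)"] unfolding split by (simp add: algebra_simps)
  qed
  have ss: "0 \<le> X s s" using form[of 1 "\<lambda>_. 0"] by simp
  have total: "(\<Sum>i\<in>insert s S. \<Sum>j\<in>insert s S. X i j * Y i j) =
      X s s * Y s s + (\<Sum>j\<in>S. X j s * (Y s j + Y j s)) + (\<Sum>i\<in>S. \<Sum>j\<in>S. X i j * Y i j)"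
    using insert.hyps by (simp add: symS sum.distrib algebra_simps)
  show ?case
  proof (cases "X s s = 0")
    case True
    \<comment> \<open>A zero diagonal entry kills its column: otherwise the form would be affine and
      nonconstant in the coefficient \<open>a\<close> at \<open>s\<close>, hence negative
      somewhere.\<close>
    have zero: "X k s = 0" if "k \<in> S" for k
    proof (rule ccontr)
      assume nz: "X k s \<noteq> 0"
      define v where "v = (\<lambda>j. if j = k then 1 else 0 :: real)"
      have "(\<Sum>j\<in>S. v j * X j s) = X k s"
        using insert.hyps that by (simp add: v_def if_distrib[of "\<lambda>t. t * _"] cong: if_cong)
      moreover have "(\<Sum>i\<in>S. \<Sum>j\<in>S. v i * v j * X i j) = X k k"
      proof -
        have "v i * v j * X i j = (if j = k then (if i = k then X k k else 0) else 0)" for i j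
          by (simp add: v_def)
        then show ?thesis using insert.hyps that by simp
      qed
      ultimately have *: "0 \<le> 2 * a * X k s + X k k" for a
        using form[of a v] True by simp
      \<comment> \<open>This \<open>a\<close> gives the affine function the value -1.\<close>
      show False
        using *[of "- (X k k + 1) / (2 * X k s)"] nz by (simp add: field_simps)
    qed
    have "0 \<le> (\<Sum>i\<in>S. \<Sum>j\<in>S. X i j * Y i j)"
      by (rule insert.IH[OF sym _ Y']) (use form[of 0] in simp)
    then show ?thesis unfolding total using True zero by simp
  next
    case False
    with ss have pos: "0 < X s s" by simp
    define Z where "Z = (\<lambda>i j. X i j - X i s * X j s / X s s)"
    have Zsum: "(\<Sum>i\<in>S. \<Sum>j\<in>S. w i j * Z i j) =
        (\<Sum>i\<in>S. \<Sum>j\<in>S. w i j * X i j) - (\<Sum>i\<in>S. \<Sum>j\<in>S. w i j * (X i s * X j s)) / X s s" for w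
      by (simp add: Z_def right_diff_distrib sum_subtractf sum_divide_distrib)
    have "0 \<le> (\<Sum>i\<in>S. \<Sum>j\<in>S. v i * v j * Z i j)" for v
    proof -
      let ?l = "\<Sum>j\<in>S. v j * X j s"
      have "(\<Sum>i\<in>S. \<Sum>j\<in>S. v i * v j * (X i s * X j s)) = ?l\<^sup>2"
        by (simp add: power2_eq_square sum_product mult_ac)
      \<comment> \<open>This coefficient at \<open>s\<close> minimises the form, and the minimum is
        the form of the Schur complement \<open>Z\<close>.\<close>
      moreover have "0 \<le> (- ?l / X s s)\<^sup>2 * X s s + 2 * (- ?l / X s s) * ?l
          + (\<Sum>i\<in>S. \<Sum>j\<in>S. v i * v j * X i j)"
        by (rule form)
      ultimately show ?thesis
        unfolding Zsum using pos by (simp add: power2_eq_square field_simps)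
    qed
    then have "0 \<le> (\<Sum>i\<in>S. \<Sum>j\<in>S. Z i j * Y i j)"
      using insert.IH[of Z, OF _ _ Y'] sym by (metis Z_def mult.commute)
    then have "(\<Sum>i\<in>S. \<Sum>j\<in>S. X i s * X j s * Y i j) / X s s \<le> (\<Sum>i\<in>S. \<Sum>j\<in>S. X i j * Y i j)"
      using Zsum[of Y] by (simp add: mult_ac)
    \<comment> \<open>Column \<open>s\<close> of \<open>X\<close> serves as test vector for
      \<open>Y\<close>; after division by \<open>X s s\<close> this is the pairing of
      \<open>Y\<close> with the rank one part that was split off.\<close>
    moreover have "0 \<le> (X s s)\<^sup>2 * Y s s + X s s * (\<Sum>j\<in>S. X j s * (Y s j + Y j s))
        + (\<Sum>i\<in>S. \<Sum>j\<in>S. X i s * X j s * Y i j)"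
      using Y[of "\<lambda>i. X i s"] unfolding split .
    then have "0 \<le> X s s * Y s s + (\<Sum>j\<in>S. X j s * (Y s j + Y j s))
        + (\<Sum>i\<in>S. \<Sum>j\<in>S. X i s * X j s * Y i j) / X s s"
      using pos by (simp add: power2_eq_square field_simps)
    ultimately show ?thesis unfolding total by linarith
  qed
qed

section \<open>The Lorentz form and arrow matrices\<close>

definition lorentz :: "real^'n::{finite,linorder} \<Rightarrow> real" where
  "lorentz y = (\<Sum>j\<in>UNIV - {last_idx}. (y $ j)\<^sup>2) - (y $ last_idx)\<^sup>2"

lemma arrow_matrix_form:
  fixes y v :: "real^'n::{finite,linorder}"
  shows "v \<bullet> (arrow_matrix y *v v) =
     y $ last_idx * (\<Sum>j\<in>UNIV - {last_idx}. (v $ j)\<^sup>2) + 2 * v $ last_idx * (\<Sum>j\<in>UNIV - {last_idx}. y $ j * v $ j)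
     + y $ last_idx * (v $ last_idx)\<^sup>2"
proof -
  let ?R = "UNIV - {last_idx :: 'n}"
  have sp: "sum g UNIV = g last_idx + sum g ?R" for g :: "'n \<Rightarrow> real"
    by (simp add: sum.remove)
  have "v $ i * (arrow_matrix y *v v) $ i = y $ i * v $ i * v $ last_idx + y $ last_idx * (v $ i)\<^sup>2"
    if "i \<in> ?R" for i
  proof -
    have "(arrow_matrix y *v v) $ i =
        arrow_matrix y $ i $ last_idx * v $ last_idx + (\<Sum>j\<in>?R. arrow_matrix y $ i $ j * v $ j)"
      by (simp only: matrix_vector_mult_def vec_lambda_beta sp)
    also have "(\<Sum>j\<in>?R. arrow_matrix y $ i $ j * v $ j) = (\<Sum>j\<in>?R. if i = j then y $ last_idx * v $ j else 0)"
      by (intro sum.cong refl) (use that in \<open>auto simp: arrow_matrix_def\<close>)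
    finally have "(arrow_matrix y *v v) $ i = y $ i * v $ last_idx + y $ last_idx * v $ i"
      using that by (simp add: arrow_matrix_def)
    then show ?thesis using that by (simp add: algebra_simps power2_eq_square)
  qed
  moreover have "(arrow_matrix y *v v) $ last_idx = y $ last_idx * v $ last_idx + (\<Sum>j\<in>?R. y $ j * v $ j)"
    by (simp add: matrix_vector_mult_def arrow_matrix_def sp)
  ultimately show ?thesis
    unfolding inner_vec_def
    by (simp add: sp sum.distrib sum_distrib_left algebra_simps power2_eq_square)
qed

lemma arrow_matrix_psd:
  fixes y :: "real^'n::{finite,linorder}"
  assumes "\<And>v. 0 \<le> v \<bullet> (arrow_matrix y *v v)"
  shows "0 \<le> y $ last_idx" "0 < y $ last_idx \<Longrightarrow> lorentz y \<le> 0"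
proof -
  let ?R = "UNIV - {last_idx :: 'n}"
  show "0 \<le> y $ last_idx"
    using assms[of "axis last_idx 1"] unfolding arrow_matrix_form by (simp add: axis_def)
  assume pos: "0 < y $ last_idx"
  \<comment> \<open>Up to scaling, this vector minimises the form over the other coordinates once
    the last one is fixed; it detects the Schur complement of the upper left block.\<close>
  define v where "v = (\<chi> j. if j = last_idx then - (y $ last_idx) else y $ j)"
  have "(\<Sum>j\<in>?R. (v $ j)\<^sup>2) = (\<Sum>j\<in>?R. (y $ j)\<^sup>2)" "(\<Sum>j\<in>?R. y $ j * v $ j) = (\<Sum>j\<in>?R. (y $ j)\<^sup>2)"
    by (auto intro!: sum.cong simp: v_def power2_eq_square)
  then have "0 \<le> y $ last_idx * (- lorentz y)"
    using assms[of v] unfolding arrow_matrix_form lorentz_def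
    by (simp add: v_def algebra_simps power2_eq_square)
  then show "lorentz y \<le> 0" using pos by (simp add: mult_le_0_iff)
qed

text \<open>The second assumption says that \<open>u\<close> and \<open>v\<close> are orthogonal for the Lorentz form.\<close>

lemma lorentz_orthogonal_timelike:
  fixes u v :: "real^'n::{finite,linorder}"
  assumes "lorentz v < 0" "lorentz (u + v) = lorentz u + lorentz v"
  shows "0 \<le> lorentz u"
proof -
  let ?R = "UNIV - {last_idx :: 'n}"
  let ?U = "\<Sum>j\<in>?R. (u $ j)\<^sup>2" and ?V = "\<Sum>j\<in>?R. (v $ j)\<^sup>2"
  \<comment> \<open>Expanding the squares of \<open>u + v\<close> leaves twice the polar form, which
    must vanish.\<close>
  have "(\<Sum>j\<in>?R. u $ j * v $ j) = u $ last_idx * v $ last_idx"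
    using assms(2) unfolding lorentz_def
    by (simp add: power2_sum sum.distrib sum_distrib_left[symmetric] mult.assoc)
  \<comment> \<open>Cauchy-Schwarz is applied away from the last coordinate, where
    \<open>lorentz v < 0\<close> bounds \<open>?V\<close>. Cancelling the positive square of
    \<open>v $ last_idx\<close> then leaves the claim.\<close>
  then have "(u $ last_idx)\<^sup>2 * (v $ last_idx)\<^sup>2 \<le> ?U * ?V"
    using Cauchy_Schwarz_ineq_sum[of "\<lambda>j. u $ j" "\<lambda>j. v $ j" ?R] by (simp add: power_mult_distrib)
  also have "\<dots> \<le> ?U * (v $ last_idx)\<^sup>2"
    using assms(1) unfolding lorentz_def by (intro mult_left_mono sum_nonneg) auto
  finally have "(u $ last_idx)\<^sup>2 * (v $ last_idx)\<^sup>2 \<le> ?U * (v $ last_idx)\<^sup>2" .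
  moreover have "0 < (v $ last_idx)\<^sup>2"
    using assms(1) sum_nonneg[of ?R "\<lambda>j. (v $ j)\<^sup>2", OF zero_le_power2] unfolding lorentz_def by linarith
  ultimately show ?thesis unfolding lorentz_def by simp
qed

section \<open>Block certificates\<close>

lemma sum_UNIV_prod:
  fixes g :: "'a::finite \<times> 'b::finite \<Rightarrow> 'c::comm_monoid_add"
  shows "(\<Sum>r\<in>UNIV. g r) = (\<Sum>i\<in>UNIV. \<Sum>a\<in>UNIV. g (i, a))"
  by (simp add: sum.cartesian_product)

lemma sum_swap_pairs:
  "(\<Sum>a\<in>A. \<Sum>b\<in>B. \<Sum>i\<in>I. \<Sum>j\<in>J. g a b i j) = (\<Sum>i\<in>I. \<Sum>j\<in>J. \<Sum>a\<in>A. \<Sum>b\<in>B. g a b i j)"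
proof -
  have "(\<Sum>a\<in>A. \<Sum>b\<in>B. \<Sum>i\<in>I. \<Sum>j\<in>J. g a b i j) = (\<Sum>i\<in>I. \<Sum>a\<in>A. \<Sum>b\<in>B. \<Sum>j\<in>J. g a b i j)"
    by (simp only: sum.swap[of _ I B]) (rule sum.swap)
  also have "\<dots> = (\<Sum>i\<in>I. \<Sum>j\<in>J. \<Sum>a\<in>A. \<Sum>b\<in>B. g a b i j)"
    by (simp only: sum.swap[of _ J B]) (intro sum.cong refl, rule sum.swap)
  finally show ?thesis .
qed

lemma block_certificate_pencil:
  assumes "block_certificate \<sigma> M F C" "psd (pencil M x)"
  shows "0 \<le> \<sigma> * (v \<bullet> (pencil F x *v v))"
proof -
  let ?X = "pencil M x"
  \<comment> \<open>\<open>Y\<close> compresses each block of \<open>C\<close> to a scalar along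
    \<open>v\<close>.\<close>
  define Y where "Y i j = (\<Sum>a\<in>UNIV. \<Sum>b\<in>UNIV. v $ a * v $ b * C $ (i, a) $ (j, b))" for i j
  have psd: "psd C" and C: "\<sigma> *\<^sub>R F p = (\<Sum>i\<in>UNIV. \<Sum>j\<in>UNIV. (M p $ i $ j) *\<^sub>R block C i j)" for p
    using assms(1) by (auto simp: block_certificate_def)
  have entry: "\<sigma> * F p $ a $ b = (\<Sum>i\<in>UNIV. \<Sum>j\<in>UNIV. M p $ i $ j * C $ (i, a) $ (j, b))" for p a b
    using arg_cong[OF C, of "\<lambda>Z. Z $ a $ b" p] by (simp add: block_def)
  have "\<sigma> * pencil F x $ a $ b = (\<Sum>p\<in>UNIV. x $ p * (\<sigma> * F p $ a $ b))" for a b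
    by (simp add: pencil_def sum_distrib_left mult_ac)
  also have "\<dots> a b = (\<Sum>p\<in>UNIV. \<Sum>i\<in>UNIV. \<Sum>j\<in>UNIV. x $ p * M p $ i $ j * C $ (i, a) $ (j, b))" for a b
    by (simp only: entry sum_distrib_left mult.assoc)
  also have "\<dots> a b = (\<Sum>i\<in>UNIV. \<Sum>j\<in>UNIV. \<Sum>p\<in>UNIV. x $ p * M p $ i $ j * C $ (i, a) $ (j, b))" for a b
    by (subst sum.swap) (intro sum.cong refl, rule sum.swap)
  also have "\<dots> a b = (\<Sum>i\<in>UNIV. \<Sum>j\<in>UNIV. ?X $ i $ j * C $ (i, a) $ (j, b))" for a b
    by (simp add: pencil_def sum_distrib_right)
  finally have X: "\<sigma> * pencil F x $ a $ b = (\<Sum>i\<in>UNIV. \<Sum>j\<in>UNIV. ?X $ i $ j * C $ (i, a) $ (j, b))" for a b .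
  have "\<sigma> * (v \<bullet> (pencil F x *v v)) =
      (\<Sum>a\<in>UNIV. \<Sum>b\<in>UNIV. v $ a * v $ b * (\<sigma> * pencil F x $ a $ b))"
    by (simp add: inner_matrix_vector_sum sum_distrib_left mult_ac)
  also have "\<dots> = (\<Sum>a\<in>UNIV. \<Sum>b\<in>UNIV. \<Sum>i\<in>UNIV. \<Sum>j\<in>UNIV. v $ a * v $ b * (?X $ i $ j * C $ (i, a) $ (j, b)))"
    by (simp only: X sum_distrib_left)
  also have "\<dots> = (\<Sum>i\<in>UNIV. \<Sum>j\<in>UNIV. ?X $ i $ j * Y i j)"
    by (subst sum_swap_pairs) (simp add: Y_def sum_distrib_left mult_ac)
  also have "0 \<le> \<dots>"
  proof (rule psd_form_pairing_nonneg)
    show "?X $ i $ j = ?X $ j $ i" for i j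
      using assms(2) unfolding psd_def symmetric_matrix_def by (metis transpose_def vec_lambda_beta)
    show "0 \<le> (\<Sum>i\<in>UNIV. \<Sum>j\<in>UNIV. w i * w j * ?X $ i $ j)" for w
    proof -
      have "0 \<le> vec_lambda w \<bullet> (?X *v vec_lambda w)" using assms(2) by (simp only: psd_def)
      then show ?thesis unfolding inner_matrix_vector_sum by simp
    qed
    show "0 \<le> (\<Sum>i\<in>UNIV. \<Sum>j\<in>UNIV. w i * w j * Y i j)" for w
    proof -
      \<comment> \<open>\<open>u\<close> is the tensor product of \<open>w\<close> and
        \<open>v\<close>: the form of \<open>Y\<close> at \<open>w\<close> is the form of
        \<open>C\<close> at \<open>u\<close>.\<close>
      define u where "u = (\<chi> r. w (fst r) * v $ snd r)"
      have "0 \<le> u \<bullet> (C *v u)" using psd by (simp add: psd_def)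
      also have "\<dots> = (\<Sum>i\<in>UNIV. \<Sum>a\<in>UNIV. \<Sum>j\<in>UNIV. \<Sum>b\<in>UNIV. w i * w j * (v $ a * v $ b * C $ (i, a) $ (j, b)))"
        unfolding inner_matrix_vector_sum u_def sum_UNIV_prod
        by (simp add: mult_ac)
      also have "\<dots> = (\<Sum>i\<in>UNIV. \<Sum>j\<in>UNIV. \<Sum>a\<in>UNIV. \<Sum>b\<in>UNIV. w i * w j * (v $ a * v $ b * C $ (i, a) $ (j, b)))"
        by (intro sum.cong refl) (rule sum.swap)
      finally show ?thesis by (simp add: Y_def sum_distrib_left)
    qed
  qed simp
  finally show ?thesis .
qed

text \<open>For fixed \<open>\<sigma>\<close>, each matrix identity splits into its entries, giving
  one scalar equation for every triple \<open>(p, a, b)\<close>.\<close>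

lemma semidefinite_feasibility_block_certificate:
  fixes M :: "'n::finite \<Rightarrow> real^'l^'l"
  shows "semidefinite_feasibility_problem (block_certificate \<sigma> M F)"
proof -
  \<comment> \<open>The coefficient matrix is the Kronecker product of \<open>M p\<close> with the
    matrix unit at \<open>(a, b)\<close>.\<close>
  define G :: "'n \<Rightarrow> 'n \<Rightarrow> 'n \<Rightarrow> real^('l \<times> 'n)^('l \<times> 'n)" where
    "G p a b = (\<chi> r s. if snd r = a \<and> snd s = b then M p $ fst r $ fst s else 0)" for p a b
  define L where "L = (\<lambda>(p, a, b). (G p a b, \<sigma> * F p $ a $ b)) ` UNIV"
  have G: "(\<Sum>r\<in>UNIV. \<Sum>s\<in>UNIV. G p a b $ r $ s * C $ r $ s) =
      (\<Sum>i\<in>UNIV. \<Sum>j\<in>UNIV. (M p $ i $ j) *\<^sub>R block C i j) $ a $ b" for p a b C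
  proof -
    have "(\<Sum>r\<in>UNIV. \<Sum>s\<in>UNIV. G p a b $ r $ s * C $ r $ s) =
        (\<Sum>i\<in>UNIV. \<Sum>a'\<in>UNIV. \<Sum>j\<in>UNIV. \<Sum>b'\<in>UNIV.
          if b' = b then if a' = a then M p $ i $ j * C $ (i, a') $ (j, b') else 0 else 0)"
      unfolding G_def sum_UNIV_prod by (intro sum.cong refl) simp
    also have "\<dots> = (\<Sum>i\<in>UNIV. \<Sum>a'\<in>UNIV. if a' = a then \<Sum>j\<in>UNIV. M p $ i $ j * C $ (i, a') $ (j, b) else 0)"
      by (intro sum.cong refl) simp
    also have "\<dots> = (\<Sum>i\<in>UNIV. \<Sum>j\<in>UNIV. M p $ i $ j * C $ (i, a) $ (j, b))"
      by simp
    finally show ?thesis by (simp add: block_def)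
  qed
  have "(\<forall>(H, \<beta>)\<in>L. (\<Sum>r\<in>UNIV. \<Sum>s\<in>UNIV. H $ r $ s * C $ r $ s) = \<beta>) \<longleftrightarrow>
      (\<forall>p. \<sigma> *\<^sub>R F p = (\<Sum>i\<in>UNIV. \<Sum>j\<in>UNIV. (M p $ i $ j) *\<^sub>R block C i j))" for C
    unfolding L_def by (auto simp: G vec_eq_iff)
  then have "{C. block_certificate \<sigma> M F C} = sdp_solutions L"
    by (auto simp: block_certificate_def sdp_solutions_def)
  moreover have "finite L" by (simp add: L_def)
  ultimately show ?thesis unfolding semidefinite_feasibility_problem_def by blast
qed

section \<open>From the initial form to the matrix\<close>

lemma real_eval_initial_form:
  "real_eval (initial_form f) z = (\<Sum>m | m \<in> Poly_Mapping.keys f \<and> monom_degree m = total_degree f.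
     of_real (Poly_Mapping.lookup f m) * (\<Prod>i\<in>UNIV. z i ^ Poly_Mapping.lookup m i))"
  by (simp add: initial_form_def)

lemma monomial_scale:
  fixes z :: "'n::finite \<Rightarrow> 'a::comm_semiring_1"
  shows "(\<Prod>i\<in>UNIV. (s * z i) ^ Poly_Mapping.lookup m i) =
     s ^ monom_degree m * (\<Prod>i\<in>UNIV. z i ^ Poly_Mapping.lookup m i)"
  by (simp add: monom_degree_def power_mult_distrib prod.distrib power_sum)

lemma monom_degree_le_total_degree:
  "m \<in> Poly_Mapping.keys f \<Longrightarrow> monom_degree m \<le> total_degree f"
  by (simp add: total_degree_def)

text \<open>The second difference \<open>f x + f (-x) - 2 f 0\<close> annihilates monomials of degree at most one.\<close>

lemma second_difference_initial_form:
  fixes x :: "real^'n::finite"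
  assumes "total_degree f = 2"
  shows "real_eval f (\<lambda>i. x $ i) + real_eval f (\<lambda>i. (- x) $ i) - 2 * real_eval f (\<lambda>i. (0::real^'n) $ i)
    = 2 * real_eval (initial_form f) (\<lambda>i. x $ i)"
proof -
  let ?K = "Poly_Mapping.keys f"
  let ?e = "\<lambda>m x. \<Prod>i\<in>UNIV. (x :: real^'n) $ i ^ Poly_Mapping.lookup m i"
  have "?e m x + ?e m (- x) - 2 * ?e m 0 = (if monom_degree m = 2 then 2 * ?e m x else 0)"
    if "m \<in> ?K" for m
  proof -
    have *: "?e m (s *\<^sub>R x) = s ^ monom_degree m * ?e m x" for s
      using monomial_scale[of s "\<lambda>i. x $ i" m] by simp
    have "monom_degree m \<in> {0, 1, 2}"
      using monom_degree_le_total_degree[OF that] assms by auto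
    \<comment> \<open>Scaling by 0 and -1 gives the values at the origin and at \<open>- x\<close>.
      In degree 0 the convention that 0 to the power 0 is 1 makes the terms cancel.\<close>
    then show ?thesis using *[of 0] *[of "-1"] by auto
  qed
  then have "(\<Sum>m\<in>?K. Poly_Mapping.lookup f m * (?e m x + ?e m (- x) - 2 * ?e m 0)) =
      (\<Sum>m\<in>?K. if monom_degree m = 2 then 2 * (Poly_Mapping.lookup f m * ?e m x) else 0)"
    by (intro sum.cong refl) simp
  also have "\<dots> = 2 * real_eval (initial_form f) (\<lambda>i. x $ i)"
    by (simp add: real_eval_initial_form assms sum.inter_filter[symmetric] sum_distrib_left)
  finally show ?thesis
    by (simp add: real_eval_def algebra_simps sum.distrib sum_subtractf sum_distrib_left)
qed

text \<open>\<open>initial_form\<close> refers to the actual total degree, so degree 2 is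
  established first. The second difference of the polynomial then equals twice either side.\<close>

lemma matrix_quadratic_form_eq_lorentz:
  fixes A T :: "real^'n::_^'n::{finite,linorder}"
  assumes "invertible T"
    and in_f: "initial_form (quadratic_poly A b c) =
           (\<Sum>j\<in>UNIV - {last_idx}. lin_form T j ^ 2) - lin_form T last_idx ^ 2"
  shows "x \<bullet> (A *v x) = lorentz (T *v x)"
proof -
  let ?f = "quadratic_poly A b c :: ('n, real) mpoly"
  have eval_in: "real_eval (initial_form ?f) (\<lambda>i. x $ i) = lorentz (T *v x)" for x :: "real^'n::_"
    unfolding in_f by (simp add: real_eval_lin_form lorentz_def)
  obtain x0 where x0: "T *v x0 = axis last_idx 1"
    by (metis assms(1) invertible_def matrix_vector_mul_assoc matrix_vector_mul_lid)
  have l0: "lorentz (s *\<^sub>R axis last_idx 1 :: real^'n::_) = - s\<^sup>2" for s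
    by (simp add: lorentz_def axis_def)
  \<comment> \<open>The initial form is nonzero at \<open>x0\<close>, so the factor gained by
    doubling the argument reveals its degree; for the Lorentz form that factor is 4.\<close>
  have "real_eval (initial_form ?f) (\<lambda>i. (2 *\<^sub>R x0) $ i) =
      2 ^ total_degree ?f * real_eval (initial_form ?f) (\<lambda>i. x0 $ i)"
    unfolding real_eval_initial_form vector_scaleR_component real_scaleR_def monomial_scale
      sum_distrib_left by (intro sum.cong refl) simp
  then have "(2::real) ^ total_degree ?f = 2 ^ 2"
    unfolding eval_in using l0[of 2] l0[of 1] by (simp add: matrix_vector_mult_scaleR x0)
  then have "total_degree ?f = 2"
    by (subst (asm) power_inject_exp) auto
  from second_difference_initial_form[OF this, of x] show ?thesis
    unfolding eval_in real_eval_quadratic_poly_real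
    by (simp add: linear_neg[OF matrix_vector_mul_linear])
qed

section \<open>The centre of a type II polynomial\<close>

lemma normal_form_II_symmetric:
  "real_eval (normal_form_II p r) (\<lambda>i. (- x) $ i) = real_eval (normal_form_II p r) (\<lambda>i. x $ i)"
  "real_eval (normal_form_II p r) (\<lambda>i. (0 :: real^'n::{finite,linorder}) $ i) = 1"
  for x :: "real^'n::{finite,linorder}"
  by (simp_all add: normal_form_II_def)

text \<open>Evenness of the normal form makes \<open>t\<close> a centre of symmetry. The part odd in
  \<open>u\<close> determines \<open>b\<close>, and the value 1 at the centre determines
  \<open>c\<close>.\<close>

lemma type_II_quadratic_poly_center:
  fixes A :: "real^'n::_^'n::{finite,linorder}"
  assumes "symmetric_matrix A" "type_II (quadratic_poly A b c)"
  obtains t where "\<And>u. b \<bullet> u = - 2 * (t \<bullet> (A *v u))" "c = 1 + t \<bullet> (A *v t)"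
proof -
  let ?g = "\<lambda>x. real_eval (quadratic_poly A b c) (\<lambda>i. x $ i) :: real"
  from assms(2) obtain S :: "real^'n::_^'n::_" and t :: "real^'n::_" and p r where
    S: "invertible S" and
    subst: "poly_subst (quadratic_poly A b c) (\<lambda>i. lin_form S i + Const (t $ i)) = normal_form_II p r"
    unfolding type_II_def by blast
  have nf: "?g (S *v x + t) = real_eval (normal_form_II p r) (\<lambda>i. x $ i)" for x
    unfolding subst[symmetric] by (simp add: real_eval_poly_subst real_eval_lin_form)
  have even: "?g (t + u) = ?g (t - u)" for u
  proof -
    obtain x where "S *v x = u"
      by (metis S invertible_def matrix_vector_mul_assoc matrix_vector_mul_lid)
    then show ?thesis
      using nf[of x] nf[of "- x"] by (simp only: normal_form_II_symmetric)
        (simp add: linear_neg[OF matrix_vector_mul_linear] add.commute)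
  qed
  have b: "b \<bullet> u = - 2 * (t \<bullet> (A *v u))" for u
    using even[of u] inner_symmetric_matrix[OF assms(1), of t u]
    unfolding real_eval_quadratic_poly_real
    by (simp add: matrix_vector_right_distrib matrix_vector_mult_diff_distrib
        inner_add_left inner_add_right inner_diff_left inner_diff_right)
  have "?g t = 1" using nf[of 0] by (simp only: normal_form_II_symmetric) simp
  then have "c = 1 + t \<bullet> (A *v t)"
    unfolding real_eval_quadratic_poly_real using b[of t] by simp
  with b show ?thesis using that by blast
qed

section \<open>Stability\<close>

text \<open>Semidefiniteness by itself gives only the closed Lorentz cone. Strictness comes from
  moving the interior point a little along the cone axis while staying in \<open>K\<close>.\<close>

lemma interior_cone_lorentz_neg:
  fixes T :: "real^'n::_^'n::{finite,linorder}"
  assumes "invertible T" "\<sigma> \<in> {-1, 1}" "v \<in> interior K"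
    and K: "\<And>x w. x \<in> K \<Longrightarrow> 0 \<le> \<sigma> * (w \<bullet> (arrow_matrix (T *v x) *v w))"
  shows "lorentz (T *v v) < 0"
proof -
  let ?e = "axis last_idx 1 :: real^'n::_"
  obtain d where d: "T *v d = ?e"
    by (metis assms(1) invertible_def matrix_vector_mul_assoc matrix_vector_mul_lid)
  obtain \<epsilon> where \<epsilon>: "\<epsilon> > 0" "ball v \<epsilon> \<subseteq> K"
    using assms(3) by (auto simp: mem_interior)
  \<comment> \<open>Moving by at most \<open>\<delta>\<close> along \<open>d\<close> stays in the
    ball; the summand 1 keeps the denominator visibly positive.\<close>
  define \<delta> where "\<delta> = \<epsilon> / (2 * (norm d + 1))"
  have \<delta>: "\<delta> > 0" using \<epsilon>(1) by (simp add: \<delta>_def add_nonneg_pos)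
  have "\<delta> * norm d < \<epsilon>"
  proof -
    have "\<delta> * norm d \<le> \<delta> * (norm d + 1)" using \<delta> by simp
    also have "\<dots> = \<epsilon> / 2" by (simp add: \<delta>_def field_simps add_nonneg_eq_0_iff)
    finally show ?thesis using \<epsilon>(1) by simp
  qed
  \<comment> \<open>The arrow matrix is linear in its vector and the Lorentz form is even, so the
    sign can be absorbed into the vector.\<close>
  define y where "y = \<sigma> *\<^sub>R (T *v v)"
  have shift: "0 \<le> w \<bullet> (arrow_matrix (y - s *\<^sub>R ?e) *v w)" if "0 \<le> s" "s \<le> \<delta>" for s w
  proof -
    have "s * norm d \<le> \<delta> * norm d" using that by (intro mult_right_mono) auto
    then have "dist v (v - (\<sigma> * s) *\<^sub>R d) < \<epsilon>"
      using assms(2) that \<open>\<delta> * norm d < \<epsilon>\<close> by (auto simp: dist_norm)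
    then have "v - (\<sigma> * s) *\<^sub>R d \<in> K" using \<epsilon>(2) by auto
    from K[OF this, of w] have
      "0 \<le> \<sigma> * (w \<bullet> (arrow_matrix (T *v v - (\<sigma> * s) *\<^sub>R ?e) *v w))"
      by (simp add: matrix_vector_mult_diff_distrib matrix_vector_mult_scaleR d)
    also have "\<dots> = w \<bullet> (arrow_matrix (\<sigma> *\<^sub>R (T *v v - (\<sigma> * s) *\<^sub>R ?e)) *v w)"
      unfolding arrow_matrix_form by (simp add: algebra_simps sum_distrib_left)
    also have "\<sigma> *\<^sub>R (T *v v - (\<sigma> * s) *\<^sub>R ?e) = y - s *\<^sub>R ?e"
      using assms(2) by (auto simp: y_def algebra_simps)
    finally show ?thesis .
  qed
  have "0 \<le> (y - \<delta> *\<^sub>R ?e) $ last_idx"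
    by (rule arrow_matrix_psd) (use shift[of \<delta>] \<delta> in simp)
  then have y: "\<delta> \<le> y $ last_idx" by (simp add: axis_def)
  \<comment> \<open>Half the step keeps the last coordinate positive, as the cone criterion
    requires, and still lowers its square strictly.\<close>
  have "lorentz (y - (\<delta> / 2) *\<^sub>R ?e) \<le> 0"
    by (rule arrow_matrix_psd) (use shift[of "\<delta> / 2"] \<delta> y in \<open>simp_all add: axis_def\<close>)
  moreover have "lorentz (y - (\<delta> / 2) *\<^sub>R ?e) =
      (\<Sum>j\<in>UNIV - {last_idx}. (y $ j)\<^sup>2) - (y $ last_idx - \<delta> / 2)\<^sup>2"
    unfolding lorentz_def by (simp add: axis_def)
  moreover have "(y $ last_idx - \<delta> / 2)\<^sup>2 < (y $ last_idx)\<^sup>2"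
    using \<delta> y by (intro power_strict_mono) auto
  ultimately have "lorentz y < 0" by (simp add: lorentz_def)
  moreover have "lorentz y = lorentz (T *v v)"
    using assms(2) by (auto simp: y_def lorentz_def)
  ultimately show ?thesis by simp
qed

lemma K_stable_quadratic_poly:
  fixes A T :: "real^'n::_^'n::{finite,linorder}"
  assumes A: "symmetric_matrix A" and "type_II (quadratic_poly A b c)"
    and form: "\<And>x. x \<bullet> (A *v x) = lorentz (T *v x)"
    and int: "\<And>v. v \<in> interior K \<Longrightarrow> lorentz (T *v v) < 0"
  shows "K_stable K (complexify (quadratic_poly A b c))"
  unfolding K_stable_def poly_eval_complexify
proof (intro allI impI notI)
  fix z :: "complex^'n::_"
  define x y where "x = (\<chi> i. Re (z $ i))" and "y = (\<chi> i. Im (z $ i))"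
  assume "(\<chi> i. Im (z $ i)) \<in> interior K"
    and zero: "real_eval (quadratic_poly A b c) (\<lambda>i. z $ i) = 0"
  then have neg: "lorentz (T *v y) < 0" using int by (simp add: y_def)
  obtain t where b: "\<And>u. b \<bullet> u = - 2 * (t \<bullet> (A *v u))" and c: "c = 1 + t \<bullet> (A *v t)"
    using type_II_quadratic_poly_center[OF assms(1,2)] by blast
  define u where "u = x - t"
  have sym: "v \<bullet> (A *v w) = w \<bullet> (A *v v)" for v w by (rule inner_symmetric_matrix[OF A])
  have re: "x \<bullet> (A *v x) - y \<bullet> (A *v y) + b \<bullet> x + c = 0"
    and im: "2 * (x \<bullet> (A *v y)) + b \<bullet> y = 0"
    using Re_Im_real_eval_quadratic_poly[OF A, of b c z] zero by (simp_all add: x_def y_def)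
  \<comment> \<open>Relative to the centre \<open>t\<close>, the linear term disappears from the
    imaginary part.\<close>
  have "u \<bullet> (A *v y) = 0"
    using im by (simp add: b u_def inner_diff_left)
  then have "lorentz (T *v u + T *v y) = lorentz (T *v u) + lorentz (T *v y)"
    using form[of "u + y"] sym[of y u]
    by (simp add: matrix_vector_right_distrib inner_add_left inner_add_right form)
  with neg have "0 \<le> lorentz (T *v u)" by (rule lorentz_orthogonal_timelike)
  \<comment> \<open>In centred coordinates the constant term is 1. The left side is now a
    nonnegative, a positive and another positive summand, so it cannot vanish.\<close>
  moreover have "lorentz (T *v u) - lorentz (T *v y) + 1 = 0"
    using re sym[of x t] unfolding form[symmetric] u_def
    by (simp add: b c matrix_vector_mult_diff_distrib inner_diff_left inner_diff_right)
  ultimately show False using neg by simp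
qed

theorem theorem4p7:
  fixes f :: "('n::{finite,linorder}, real) mpoly"
    and A :: "real^'n::_^'n::_" and b :: "real^'n::_" and c :: real
    and K :: "(real^'n::_) set"
    and M :: "'n \<Rightarrow> real^'l^'l"
    and T :: "real^'n::_^'n::_"
    and F :: "'n \<Rightarrow> real^'n::_^'n::_"
  assumes "CARD('n) \<ge> 3"
    and "symmetric_matrix A"
    and "f = quadratic_poly A b c"
    and "type_II f"
    and "has_signature A (CARD('n) - 1) 1"
    and "irreducible (initial_form f)"
    and "proper_cone K"
    and "\<And>j. symmetric_matrix (M j)"
    and "K = {x. psd (pencil M x)}"
    and "invertible T"
    and "initial_form f =
           (\<Sum>j\<in>UNIV - {last_idx}. lin_form T j ^ 2) - lin_form T last_idx ^ 2"
    and "\<And>x. pencil F x = arrow_matrix (T *v x)"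
  shows "((\<exists>\<sigma>\<in>{-1, 1}. \<exists>C :: real^('l \<times> 'n::_)^('l \<times> 'n::_). block_certificate \<sigma> M F C)
            \<longrightarrow> K_stable K (complexify f))
         \<and> (\<forall>\<sigma>\<in>{-1, 1}. semidefinite_feasibility_problem
              (\<lambda>C :: real^('l \<times> 'n::_)^('l \<times> 'n::_). block_certificate \<sigma> M F C))"
proof (intro conjI impI ballI semidefinite_feasibility_block_certificate)
  assume "\<exists>\<sigma>\<in>{-1, 1}. \<exists>C :: real^('l \<times> 'n)^('l \<times> 'n). block_certificate \<sigma> M F C"
  then obtain \<sigma> and C :: "real^('l \<times> 'n)^('l \<times> 'n)" where
    \<sigma>: "\<sigma> \<in> {-1, 1}" and C: "block_certificate \<sigma> M F C" by blast
  have "0 \<le> \<sigma> * (w \<bullet> (arrow_matrix (T *v x) *v w))" if "x \<in> K" for x w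
    using block_certificate_pencil[OF C, of x w] that assms(9,12) by simp
  then have "lorentz (T *v v) < 0" if "v \<in> interior K" for v
    using interior_cone_lorentz_neg[OF assms(10) \<sigma> that] by blast
  moreover have "x \<bullet> (A *v x) = lorentz (T *v x)" for x
    using matrix_quadratic_form_eq_lorentz assms(3,10,11) by blast
  ultimately show "K_stable K (complexify f)"
    using K_stable_quadratic_poly assms(2-4) by blast
qed

end
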